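(* Let $L$ be a planar triangulation with $n_L\ge 3$ vertices, embedded in the plane, and let $H$ be its planar conjugated triangulation. Every vertex of $H$ lying on the boundary of a face of the second class of $H$ has degree $4$ in $H$.
   Context: A planar triangulation is a maximal planar simple graph; fix a plane embedding of $L$, so all faces of $L$ are triangles. The planar conjugated triangulation $H$ of $L$ is the plane graph whose vertices are the midpoints of the edges of $L$, and in which, for every bounded face of $L$, the three midpoints of its three boundary edges are joined pairwise by three segments (medians) drawn inside that face; nothing is drawn inside the unbounded face of $L$. A bounded face of $H$ is of the second class if it contains a vertex of $L$ in its interior. *)

theory Defs
  imports "HOL-Analysis.Analysis"
begin

definition simple_graph :: "'a set \<Rightarrow> 'a set set \<Rightarrow> bool" where
  "simple_graph V E \<longleftrightarrow> finite V \<and> (\<forall>e\<in>E. e \<subseteq> V \<and> card e = 2)"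

definition vertex_degree :: "'a set set \<Rightarrow> 'a \<Rightarrow> nat" where
  "vertex_degree E v = card {e \<in> E. v \<in> e}"

definition plane_embedding ::
    "'a set \<Rightarrow> 'a set set \<Rightarrow> ('a \<Rightarrow> complex) \<Rightarrow> ('a set \<Rightarrow> real \<Rightarrow> complex) \<Rightarrow> bool" where
  "plane_embedding V E p g \<longleftrightarrow>
     inj_on p V \<and>
     (\<forall>e\<in>E. arc (g e) \<and> {pathstart (g e), pathfinish (g e)} = p ` e
        \<and> path_image (g e) \<inter> p ` V = p ` e) \<and>
     (\<forall>e\<in>E. \<forall>e'\<in>E. e \<noteq> e' \<longrightarrow> path_image (g e) \<inter> path_image (g e') \<subseteq> p ` (e \<inter> e'))"

definition planar :: "'a set \<Rightarrow> 'a set set \<Rightarrow> bool" where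
  "planar V E \<longleftrightarrow> (\<exists>p g. plane_embedding V E p g)"

definition maximal_planar :: "'a set \<Rightarrow> 'a set set \<Rightarrow> bool" where
  "maximal_planar V E \<longleftrightarrow> simple_graph V E \<and> planar V E \<and>
     (\<forall>u\<in>V. \<forall>v\<in>V. u \<noteq> v \<and> {u, v} \<notin> E \<longrightarrow> \<not> planar V (insert {u, v} E))"

definition drawing ::
    "'a set \<Rightarrow> 'a set set \<Rightarrow> ('a \<Rightarrow> complex) \<Rightarrow> ('a set \<Rightarrow> real \<Rightarrow> complex) \<Rightarrow> complex set" where
  "drawing V E p g = p ` V \<union> (\<Union>e\<in>E. path_image (g e))"

definition faces ::
    "'a set \<Rightarrow> 'a set set \<Rightarrow> ('a \<Rightarrow> complex) \<Rightarrow> ('a set \<Rightarrow> real \<Rightarrow> complex) \<Rightarrow> complex set set" where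
  "faces V E p g = components (- drawing V E p g)"

definition boundary_edges ::
    "'a set set \<Rightarrow> ('a set \<Rightarrow> real \<Rightarrow> complex) \<Rightarrow> complex set \<Rightarrow> 'a set set" where
  "boundary_edges E g F = {e \<in> E. path_image (g e) \<subseteq> frontier F}"

definition triangular_face ::
    "'a set set \<Rightarrow> ('a set \<Rightarrow> real \<Rightarrow> complex) \<Rightarrow> complex set \<Rightarrow> bool" where
  "triangular_face E g F \<longleftrightarrow>
     (\<exists>a b c. a \<noteq> b \<and> b \<noteq> c \<and> a \<noteq> c \<and> {a, b} \<in> E \<and> {b, c} \<in> E \<and> {a, c} \<in> E \<and>
        frontier F = path_image (g {a, b}) \<union> path_image (g {b, c}) \<union> path_image (g {a, c}))"

text \<open>For at least three vertices the last conjunct below is the standard consequence of the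
  first two: every face of an embedded maximal planar graph is a triangle.\<close>

definition plane_triangulation ::
    "'a set \<Rightarrow> 'a set set \<Rightarrow> ('a \<Rightarrow> complex) \<Rightarrow> ('a set \<Rightarrow> real \<Rightarrow> complex) \<Rightarrow> bool" where
  "plane_triangulation V E p g \<longleftrightarrow>
     maximal_planar V E \<and> plane_embedding V E p g \<and> (\<forall>F\<in>faces V E p g. triangular_face E g F)"

text \<open>The vertices of the conjugated triangulation are the edges of the triangulation, each placed
  at the parameter midpoint of its arc. For a straight edge \<open>linepath x y\<close> this is the Euclidean
  midpoint; for a curved edge, reparametrisation allows any interior point of the arc.\<close>

definition edge_midpoint :: "('a set \<Rightarrow> real \<Rightarrow> complex) \<Rightarrow> 'a set \<Rightarrow> complex" where
  "edge_midpoint g e = g e (1/2)"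

definition conj_edges ::
    "'a set \<Rightarrow> 'a set set \<Rightarrow> ('a \<Rightarrow> complex) \<Rightarrow> ('a set \<Rightarrow> real \<Rightarrow> complex) \<Rightarrow> 'a set set set" where
  "conj_edges V E p g =
     {{e, e'} | e e'. e \<noteq> e' \<and>
        (\<exists>F\<in>faces V E p g. bounded F \<and> e \<in> boundary_edges E g F \<and> e' \<in> boundary_edges E g F)}"

text \<open>\<open>m {e, e'}\<close> is the median joining the midpoints of \<open>e\<close> and \<open>e'\<close>. It is an arc rather than a
  straight segment, because the faces of the triangulation may be curved. Indexing medians
  by \<open>{e, e'}\<close> alone loses nothing: two bounded triangular faces of a simple plane graph sharing two
  edges have the same three boundary edges and hence coincide.\<close>

definition conjugated_triangulation ::
    "'a set \<Rightarrow> 'a set set \<Rightarrow> ('a \<Rightarrow> complex) \<Rightarrow> ('a set \<Rightarrow> real \<Rightarrow> complex) \<Rightarrow>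
     ('a set set \<Rightarrow> real \<Rightarrow> complex) \<Rightarrow> bool" where
  "conjugated_triangulation V E p g m \<longleftrightarrow>
     plane_embedding E (conj_edges V E p g) (edge_midpoint g) m \<and>
     (\<forall>F\<in>faces V E p g. bounded F \<longrightarrow>
        (\<forall>e\<in>boundary_edges E g F. \<forall>e'\<in>boundary_edges E g F. e \<noteq> e' \<longrightarrow>
           path_image (m {e, e'}) - {edge_midpoint g e, edge_midpoint g e'} \<subseteq> F))"

definition conj_faces ::
    "'a set \<Rightarrow> 'a set set \<Rightarrow> ('a \<Rightarrow> complex) \<Rightarrow> ('a set \<Rightarrow> real \<Rightarrow> complex) \<Rightarrow>
     ('a set set \<Rightarrow> real \<Rightarrow> complex) \<Rightarrow> complex set set" where
  "conj_faces V E p g m = faces E (conj_edges V E p g) (edge_midpoint g) m"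

definition second_class_face ::
    "'a set \<Rightarrow> 'a set set \<Rightarrow> ('a \<Rightarrow> complex) \<Rightarrow> ('a set \<Rightarrow> real \<Rightarrow> complex) \<Rightarrow>
     ('a set set \<Rightarrow> real \<Rightarrow> complex) \<Rightarrow> complex set \<Rightarrow> bool" where
  "second_class_face V E p g m F \<longleftrightarrow>
     F \<in> conj_faces V E p g m \<and> bounded F \<and> (\<exists>v\<in>V. p v \<in> interior F)"

end

theory Submission
  imports Defs
begin

text \<open>By the Jordan curve theorem every bounded face of \<open>L\<close> is the inside of its boundary triangle.
  The three medians cut such a triangle into a central triangle and three corners. If an edge \<open>e\<close>
  lay on the boundary of the unbounded face \<open>W\<close>, then the corners at the two ends of \<open>e\<close> would be
  connected to \<open>W\<close> off \<open>H\<close>, while the central triangle contains no vertex of \<open>L\<close>; no face of the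
  second class could have the midpoint of \<open>e\<close> on its boundary. So both faces of \<open>L\<close> at \<open>e\<close> are
  bounded, and each of them contributes two medians at \<open>e\<close>. That no third face meets \<open>e\<close> follows
  from Janiszewski's theorem, applied to the theta graph formed by \<open>e\<close> and the two paths that
  complete it to the triangles on either side.\<close>

section \<open>Arcs, Jordan curves and theta graphs\<close>

text \<open>Arcs are treated as point sets with named ends, forgetting the parametrisation. Gluing
  and cutting then reduce to conditions on unions and intersections.\<close>

definition arc_between :: "complex set \<Rightarrow> complex \<Rightarrow> complex \<Rightarrow> bool" where
  "arc_between A u v \<longleftrightarrow>
     (\<exists>\<gamma>. arc \<gamma> \<and> path_image \<gamma> = A \<and> pathstart \<gamma> = u \<and> pathfinish \<gamma> = v)"

definition Jordan :: "complex set \<Rightarrow> bool" where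
  "Jordan C \<longleftrightarrow> (\<exists>c. simple_path c \<and> pathfinish c = pathstart c \<and> path_image c = C)"

lemma arc_between_sym: "arc_between A u v \<Longrightarrow> arc_between A v u"
  unfolding arc_between_def
  by (metis arc_reversepath path_image_reversepath pathfinish_reversepath pathstart_reversepath)

lemma arc_between_ends:
  assumes "arc_between A u v"
  shows "u \<in> A" "v \<in> A" "u \<noteq> v"
  using assms unfolding arc_between_def
  by (auto dest: arc_distinct_ends)

lemma arc_between_join:
  assumes "arc_between A u v" "arc_between B v w" "A \<inter> B = {v}"
  shows "arc_between (A \<union> B) u w"
proof -
  obtain \<gamma> \<delta> where "arc \<gamma>" "path_image \<gamma> = A" "pathstart \<gamma> = u" "pathfinish \<gamma> = v"
    "arc \<delta>" "path_image \<delta> = B" "pathstart \<delta> = v" "pathfinish \<delta> = w"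
    using assms unfolding arc_between_def by blast
  then show ?thesis
    unfolding arc_between_def using assms(3)
    by (intro exI[of _ "\<gamma> +++ \<delta>"]) (auto simp: arc_join_eq path_image_join)
qed

text \<open>Injectivity on the unit interval turns the overlap of the two parameter halves into the
  overlap of their images. The parameter 1/2 is the one at which \<open>edge_midpoint\<close> places
  the vertices of the conjugated triangulation.\<close>

lemma arc_split_half:
  fixes \<gamma> :: "real \<Rightarrow> complex"
  assumes "arc \<gamma>"
  obtains A B where "path_image \<gamma> = A \<union> B" "A \<inter> B = {\<gamma> (1/2)}"
    "arc_between A (pathstart \<gamma>) (\<gamma> (1/2))" "arc_between B (\<gamma> (1/2)) (pathfinish \<gamma>)"
proof
  let ?A = "path_image (subpath 0 (1/2) \<gamma>)" and ?B = "path_image (subpath (1/2) 1 \<gamma>)"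
  have inj: "inj_on \<gamma> {0..1}"
    using assms by (simp add: arc_def)
  have "path_image (subpath 0 (1/2) \<gamma> +++ subpath (1/2) 1 \<gamma>) = path_image \<gamma>"
    by (simp only: join_subpaths_middle)
  then show "path_image \<gamma> = ?A \<union> ?B"
    by (simp add: path_image_join)
  have "{0..1/2} \<inter> {1/2..1} = {1/2::real}" by auto
  moreover have "\<gamma> ` ({0..1/2} \<inter> {1/2..1}) = \<gamma> ` {0..1/2} \<inter> \<gamma> ` {1/2..1}"
    by (rule inj_on_image_Int[OF inj]) auto
  ultimately show "?A \<inter> ?B = {\<gamma> (1/2)}"
    by (simp add: path_image_subpath)
  show "arc_between ?A (pathstart \<gamma>) (\<gamma> (1/2))"
    unfolding arc_between_def using assms
    by (intro exI[of _ "subpath 0 (1/2) \<gamma>"]) (auto simp: arc_subpath_arc pathstart_def[of \<gamma>])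
  show "arc_between ?B (\<gamma> (1/2)) (pathfinish \<gamma>)"
    unfolding arc_between_def using assms
    by (intro exI[of _ "subpath (1/2) 1 \<gamma>"]) (auto simp: arc_subpath_arc pathfinish_def[of \<gamma>])
qed

lemma compact_arc_between: "arc_between A u v \<Longrightarrow> compact A"
  unfolding arc_between_def using compact_arc_image by blast

lemma connected_arc_between: "arc_between A u v \<Longrightarrow> connected A"
  unfolding arc_between_def using connected_arc_image by blast

lemma connected_arc_between_endless: "arc_between A u v \<Longrightarrow> connected (A - {u,v})"
  unfolding arc_between_def using connected_simple_path_endless arc_imp_simple_path by metis

text \<open>A connected set with more than one point has no isolated points, and deleting finitely
  many points does not change which points are limit points.\<close>

lemma arc_between_subset_closure:
  assumes "arc_between A u v"
  shows "A \<subseteq> closure (A - {u,v})"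
proof
  fix z assume z: "z \<in> A"
  have "z islimpt A"
  proof (rule connected_imp_perfect[OF connected_arc_between[OF assms] z])
    show "A \<noteq> {y}" for y using arc_between_ends[OF assms] by blast
  qed
  moreover have "A = {u,v} \<union> (A - {u,v})"
    using arc_between_ends[OF assms] by blast
  ultimately have "z islimpt (A - {u,v})"
    using islimpt_Un_finite[of "{u,v}" z "A - {u,v}"] by simp
  then show "z \<in> closure (A - {u,v})" by (simp add: closure_def)
qed

text \<open>The inverse of the parametrisation would embed a nonempty open subset of the plane into
  the line, against invariance of dimension.\<close>

lemma interior_arc_image_empty:
  fixes \<gamma> :: "real \<Rightarrow> complex"
  assumes "arc \<gamma>"
  shows "interior (path_image \<gamma>) = {}"
proof (rule ccontr)
  assume ne: "interior (path_image \<gamma>) \<noteq> {}"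
  obtain h where h: "homeomorphism {0..1} (path_image \<gamma>) \<gamma> h"
    using homeomorphism_arc[OF assms] .
  have "continuous_on (interior (path_image \<gamma>)) h"
    by (meson h continuous_on_subset homeomorphism_cont2 interior_subset)
  moreover have "inj_on h (interior (path_image \<gamma>))"
    by (metis h homeomorphism_def inj_on_inverseI inj_on_subset interior_subset)
  ultimately have "DIM(complex) \<le> DIM(real)"
    using invariance_of_dimension[OF _ open_interior _ ne] by blast
  then show False by simp
qed

section \<open>Jordan curves and their two sides\<close>

lemma Jordan_inside_outside_set:
  assumes "Jordan C"
  shows "compact C" "inside C \<noteq> {}" "open (inside C)" "connected (inside C)"
    "outside C \<noteq> {}" "open (outside C)" "connected (outside C)" "bounded (inside C)"
    "\<not> bounded (outside C)" "frontier (inside C) = C" "frontier (outside C) = C"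
proof -
  obtain c where c: "simple_path c" "pathfinish c = pathstart c" "path_image c = C"
    using assms unfolding Jordan_def by blast
  show "compact C"
    using c compact_simple_path_image by blast
  show "inside C \<noteq> {}" "open (inside C)" "connected (inside C)"
    "outside C \<noteq> {}" "open (outside C)" "connected (outside C)" "bounded (inside C)"
    "\<not> bounded (outside C)" "frontier (inside C) = C" "frontier (outside C) = C"
    using Jordan_inside_outside[OF c(1,2)] c(3) by auto
qed

lemma Jordan_closure_inside:
  assumes "Jordan C"
  shows "closure (inside C) = inside C \<union> C"
  using Jordan_inside_outside_set[OF assms] closure_Un_frontier[of "inside C"] by simp

lemma Jordan_arcs:
  assumes "arc_between A u v" "arc_between B u v" "A \<inter> B = {u,v}"
  shows "Jordan (A \<union> B)"
proof -
  obtain \<gamma> \<delta> where *: "arc \<gamma>" "path_image \<gamma> = A" "pathstart \<gamma> = u" "pathfinish \<gamma> = v"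
    "arc \<delta>" "path_image \<delta> = B" "pathstart \<delta> = v" "pathfinish \<delta> = u"
    using assms(1) arc_between_sym[OF assms(2)] unfolding arc_between_def by blast
  then show ?thesis
    unfolding Jordan_def using assms(3)
    by (intro exI[of _ "\<gamma> +++ \<delta>"]) (auto simp: simple_path_join_loop_eq path_image_join)
qed

text \<open>This is \<open>split_inside_simple_closed_curve\<close> for point sets: the chord
  \<open>R\<close> cuts the inside of the closed curve formed by \<open>P\<close> and
  \<open>Q\<close>. It is the one tool with which the medians are later cut in.\<close>

lemma split_inside_arcs:
  assumes P: "arc_between P u v" and Q: "arc_between Q u v" and R: "arc_between R u v"
    and PQ: "P \<inter> Q = {u,v}" and PR: "P \<inter> R = {u,v}" and QR: "Q \<inter> R = {u,v}"
    and ne: "R \<inter> inside (P \<union> Q) \<noteq> {}"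
  shows "inside (P \<union> R) \<inter> inside (Q \<union> R) = {}"
    and "inside (P \<union> R) \<union> inside (Q \<union> R) \<union> (R - {u,v}) = inside (P \<union> Q)"
proof -
  obtain c1 where c1: "arc c1" "path_image c1 = P" "pathstart c1 = u" "pathfinish c1 = v"
    using P unfolding arc_between_def by blast
  obtain c2 where c2: "arc c2" "path_image c2 = Q" "pathstart c2 = u" "pathfinish c2 = v"
    using Q unfolding arc_between_def by blast
  obtain c where c: "arc c" "path_image c = R" "pathstart c = u" "pathfinish c = v"
    using R unfolding arc_between_def by blast
  have "u \<noteq> v" using P arc_between_ends by blast
  then show "inside (P \<union> R) \<inter> inside (Q \<union> R) = {}"
    and "inside (P \<union> R) \<union> inside (Q \<union> R) \<union> (R - {u,v}) = inside (P \<union> Q)"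
    using split_inside_simple_closed_curve[of c1 u v c2 c] assms c1 c2 c arc_imp_simple_path
    by metis+
qed

text \<open>A connected set that meets another set but not its frontier lies within it. Since
  \<open>F\<close> and the sides of \<open>C\<close> are connected, avoid \<open>C\<close> and have
  frontier \<open>C\<close>, this gives both inclusions between \<open>F\<close> and the side that
  it meets.\<close>

lemma component_of_Jordan_complement:
  assumes "Jordan C" "open F" "connected F" "F \<noteq> {}" "frontier F = C"
  shows "F = inside C \<or> F = outside C"
proof -
  note J = Jordan_inside_outside_set[OF assms(1)]
  have disj: "F \<inter> C = {}"
    using assms(2,5) by (metis Int_commute frontier_disjoint_eq)
  have sub: "S \<subseteq> F" if "connected S" "S \<inter> C = {}" "F \<inter> S \<noteq> {}" for S
    using connected_Int_frontier[OF that(1), of F] that assms(5) by blast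
  have "F \<subseteq> inside C \<union> outside C" using disj by auto
  then have "F \<inter> inside C \<noteq> {} \<or> F \<inter> outside C \<noteq> {}" using assms(4) by blast
  then show ?thesis
  proof
    assume *: "F \<inter> inside C \<noteq> {}"
    then have "inside C \<subseteq> F" using sub J(4) inside_no_overlap by blast
    moreover have "F \<subseteq> inside C"
      using connected_Int_frontier[OF assms(3), of "inside C"] * J(10) disj by blast
    ultimately show ?thesis by blast
  next
    assume *: "F \<inter> outside C \<noteq> {}"
    then have "outside C \<subseteq> F" using sub J(7) outside_no_overlap by blast
    moreover have "F \<subseteq> outside C"
      using connected_Int_frontier[OF assms(3), of "outside C"] * J(11) disj by blast
    ultimately show ?thesis by blast
  qed
qed

lemma connected_component_Jordan_outside:
  assumes "Jordan C" "y \<in> outside C" "z \<in> outside C"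
  shows "connected_component (- C) y z"
  unfolding connected_component_def
  using Jordan_inside_outside_set(7)[OF assms(1)] assms(2,3) outside_no_overlap by blast

section \<open>Theta graphs\<close>

text \<open>By Janiszewski's theorem, a point that lies outside both curves through \<open>A\<close> is joined to
  infinity off the whole theta graph, so it cannot lie inside the third curve.\<close>

lemma theta_inside_subset:
  assumes A: "arc_between A u v" and P: "arc_between P u v" and Q: "arc_between Q u v"
    and AP: "A \<inter> P = {u,v}" and AQ: "A \<inter> Q = {u,v}" and PQ: "P \<inter> Q = {u,v}"
  shows "inside (P \<union> Q) \<subseteq> inside (A \<union> P) \<union> inside (A \<union> Q) \<union> A"
proof
  fix y assume y: "y \<in> inside (P \<union> Q)"
  have JP: "Jordan (A \<union> P)" and JQ: "Jordan (A \<union> Q)" and J: "Jordan (P \<union> Q)"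
    using Jordan_arcs assms by auto
  show "y \<in> inside (A \<union> P) \<union> inside (A \<union> Q) \<union> A"
  proof (rule ccontr)
    assume *: "y \<notin> inside (A \<union> P) \<union> inside (A \<union> Q) \<union> A"
    have "y \<notin> P \<union> Q" using y inside_no_overlap by blast
    with * have yo: "y \<in> outside (A \<union> P)" "y \<in> outside (A \<union> Q)"
      using inside_Un_outside by blast+
    \<comment> \<open>A point \<open>z\<close> beyond a ball around the whole graph plays the role
      of infinity: it lies outside all three closed curves at once.\<close>
    have "bounded (A \<union> P \<union> Q)"
      using A P Q compact_arc_between compact_imp_bounded by (metis bounded_Un)
    then obtain r where r: "A \<union> P \<union> Q \<subseteq> ball 0 r"
      using bounded_subset_ballD by blast
    then have "- ball 0 r \<subseteq> outside S" if "S \<subseteq> A \<union> P \<union> Q" for S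
      using outside_subset_convex[of "ball 0 r" S] that by auto
    moreover obtain z where "z \<in> - ball (0::complex) r"
      using cobounded_imp_unbounded[of "- ball (0::complex) r"] bounded_ball
      by (metis bounded_empty double_complement equals0I)
    ultimately have z: "z \<in> outside (A \<union> P)" "z \<in> outside (A \<union> Q)" "z \<in> outside (P \<union> Q)"
      by blast+
    \<comment> \<open>The two curves share exactly the arc \<open>A\<close>. Its connectedness is
      the condition under which Janiszewski's theorem joins \<open>y\<close> to \<open>z\<close> off
      their union.\<close>
    have "(A \<union> P) \<inter> (A \<union> Q) = A"
      using AP AQ PQ by auto
    then have "connected_component (- ((A \<union> P) \<union> (A \<union> Q))) y z"
      using Janiszewski[of "A \<union> P" "A \<union> Q" y z] connected_arc_between[OF A] JP JQ yo z
        Jordan_inside_outside_set(1) compact_imp_closed connected_component_Jordan_outside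
      by metis
    then have "connected_component (- (P \<union> Q)) y z"
      by (rule connected_component_of_subset) auto
    then have "z \<in> inside (P \<union> Q)"
      using y inside_same_component by blast
    then show False using z inside_Int_outside by blast
  qed
qed

text \<open>Some point \<open>y\<close> inside the outer curve is off \<open>A\<close>, hence lies
  in one of the two regions at \<open>A\<close>. That region avoids \<open>P\<close> and
  \<open>Q\<close> and has all of \<open>A\<close> in its closure, so it links \<open>y\<close> to
  every inner point of \<open>A\<close> without crossing the outer curve.\<close>

lemma theta_middle_inside:
  assumes A: "arc_between A u v" and P: "arc_between P u v" and Q: "arc_between Q u v"
    and AP: "A \<inter> P = {u,v}" and AQ: "A \<inter> Q = {u,v}" and PQ: "P \<inter> Q = {u,v}"
    and "inside (A \<union> P) \<inter> Q = {}" "inside (A \<union> Q) \<inter> P = {}"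
  shows "A - {u,v} \<subseteq> inside (P \<union> Q)"
proof
  fix x assume x: "x \<in> A - {u,v}"
  have JP: "Jordan (A \<union> P)" and JQ: "Jordan (A \<union> Q)" and J: "Jordan (P \<union> Q)"
    using Jordan_arcs assms by auto
  have x': "x \<notin> P \<union> Q" using x AP AQ by blast
  have "interior A = {}"
    using A interior_arc_image_empty unfolding arc_between_def by blast
  \<comment> \<open>The inside is open and nonempty, so it does not fit into an arc.\<close>
  then have "\<not> inside (P \<union> Q) \<subseteq> A"
    using Jordan_inside_outside_set[OF J] by (metis interior_maximal subset_empty)
  then obtain y where y: "y \<in> inside (P \<union> Q)" "y \<notin> A" by blast
  \<comment> \<open>Adding a limit point keeps \<open>S\<close> connected, so \<open>x\<close> falls
    into the same component of the complement as \<open>y\<close>.\<close>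
  have key: "x \<in> inside (P \<union> Q)" if S: "y \<in> S" "connected S" "S \<inter> (P \<union> Q) = {}" "x \<in> closure S" for S
  proof -
    have "connected (insert x S)"
      by (rule connected_intermediate_closure[OF S(2)]) (use S(4) closure_subset in auto)
    then have "connected_component (- (P \<union> Q)) y x"
      unfolding connected_component_def using S x' by blast
    then show ?thesis using y inside_same_component by blast
  qed
  have "y \<in> inside (A \<union> P) \<or> y \<in> inside (A \<union> Q)"
    using theta_inside_subset[OF A P Q AP AQ PQ] y by blast
  then show "x \<in> inside (P \<union> Q)"
  proof
    assume "y \<in> inside (A \<union> P)"
    moreover have "inside (A \<union> P) \<inter> (P \<union> Q) = {}"
      using assms(7) inside_no_overlap[of "A \<union> P"] by blast
    moreover have "x \<in> closure (inside (A \<union> P))"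
      using x Jordan_closure_inside[OF JP] by blast
    ultimately show ?thesis
      using key Jordan_inside_outside_set(4)[OF JP] by blast
  next
    assume "y \<in> inside (A \<union> Q)"
    moreover have "inside (A \<union> Q) \<inter> (P \<union> Q) = {}"
      using assms(8) inside_no_overlap[of "A \<union> Q"] by blast
    moreover have "x \<in> closure (inside (A \<union> Q))"
      using x Jordan_closure_inside[OF JQ] by blast
    ultimately show ?thesis
      using key Jordan_inside_outside_set(4)[OF JQ] by blast
  qed
qed

section \<open>Cutting a triangle along its medians\<close>

text \<open>The arc without its ends is connected, so it stays within one of the two open sets. In
  \<open>U\<close> it would drag both ends into the closure of \<open>U\<close>. This decides on
  which side of one median the next one runs.\<close>

lemma connected_arc_interior_cases:
  assumes h: "arc_between h y z" and sub: "h - {y,z} \<subseteq> U \<union> W" and "open U" "open W" "U \<inter> W = {}"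
    and "y \<notin> closure U \<or> z \<notin> closure U"
  shows "h - {y,z} \<subseteq> W"
proof (rule ccontr)
  assume n: "\<not> h - {y,z} \<subseteq> W"
  have "connected (h - {y,z})"
    using h by (rule connected_arc_between_endless)
  then have "h - {y,z} \<subseteq> U"
    using n sub assms(3-5) connectedD[of "h - {y,z}" U W] by blast
  then have "closure (h - {y,z}) \<subseteq> closure U"
    by (rule closure_mono)
  then have "h \<subseteq> closure U"
    using arc_between_subset_closure[OF h] by blast
  then show False using assms(6) arc_between_ends[OF h] by blast
qed

text \<open>The cut points differ from \<open>a\<close>, so \<open>a\<close> is missing from the far
  halves \<open>A2\<close> and \<open>B2\<close>, and only the near halves can share it.\<close>

lemma split_sides_meet:
  assumes "(A1 \<union> A2) \<inter> (B1 \<union> B2) = {a}" "A1 \<inter> A2 = {x}" "B1 \<inter> B2 = {y}"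
    "a \<in> A1" "a \<in> B1" "a \<noteq> x" "a \<noteq> y"
  shows "A1 \<inter> B1 = {a}" "A1 \<inter> B2 = {}" "A2 \<inter> B1 = {}" "A2 \<inter> B2 = {}"
proof -
  have "a \<notin> A2" "a \<notin> B2"
    using assms(2-7) by (metis IntI singletonD)+
  moreover have "A1 \<inter> B1 \<subseteq> {a}" "A1 \<inter> B2 \<subseteq> {a}" "A2 \<inter> B1 \<subseteq> {a}" "A2 \<inter> B2 \<subseteq> {a}"
    unfolding assms(1)[symmetric] by blast+
  ultimately show "A1 \<inter> B1 = {a}" "A1 \<inter> B2 = {}" "A2 \<inter> B1 = {}" "A2 \<inter> B2 = {}"
    using assms(4,5) by blast+
qed

text \<open>Three cuts in turn: \<open>h1\<close> cuts off the corner \<open>Ka\<close> at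
  \<open>a\<close> and leaves \<open>N\<close>, \<open>h2\<close> cuts off the corner
  \<open>Kb\<close> at \<open>b\<close> and leaves \<open>M\<close>, and \<open>h3\<close> cuts
  \<open>M\<close> into the corner \<open>Kc\<close> at \<open>c\<close> and the central piece
  \<open>I\<close>. The points \<open>x\<close>, \<open>y\<close>, \<open>z\<close> are the
  midpoints of the sides \<open>ab\<close>, \<open>ac\<close>, \<open>bc\<close>, which are given by
  their halves \<open>A1\<close>, \<open>A2\<close>, \<open>B1\<close>, \<open>B2\<close>,
  \<open>D1\<close>, \<open>D2\<close>.\<close>

lemma medians_split_triangle:
  fixes A1 A2 B1 B2 D1 D2 h1 h2 h3 T :: "complex set"
  defines "T \<equiv> inside (A1 \<union> A2 \<union> (B1 \<union> B2) \<union> (D1 \<union> D2))"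
  assumes A1: "arc_between A1 a x" and A2: "arc_between A2 x b" and A12: "A1 \<inter> A2 = {x}"
    and B1: "arc_between B1 a y" and B2: "arc_between B2 y c" and B12: "B1 \<inter> B2 = {y}"
    and D1: "arc_between D1 b z" and D2: "arc_between D2 z c" and D12: "D1 \<inter> D2 = {z}"
    and AB: "(A1 \<union> A2) \<inter> (B1 \<union> B2) = {a}" and AD: "(A1 \<union> A2) \<inter> (D1 \<union> D2) = {b}"
    and BD: "(B1 \<union> B2) \<inter> (D1 \<union> D2) = {c}"
    and h1: "arc_between h1 x y" and h2: "arc_between h2 x z" and h3: "arc_between h3 y z"
    and h1T: "h1 - {x,y} \<subseteq> T" and h2T: "h2 - {x,z} \<subseteq> T" and h3T: "h3 - {y,z} \<subseteq> T"
    and h12: "h1 \<inter> h2 = {x}" and h13: "h1 \<inter> h3 = {y}" and h23: "h2 \<inter> h3 = {z}"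
  obtains Ka Kb Kc I
  where "T - (h1 \<union> h2 \<union> h3) = Ka \<union> Kb \<union> Kc \<union> I"
    "connected Ka" "connected Kb" "a \<in> closure Ka" "b \<in> closure Kb" "x \<notin> closure Kc"
    "frontier I \<subseteq> h1 \<union> h2 \<union> h3"
proof -
  have TC: "T \<inter> (A1 \<union> A2 \<union> (B1 \<union> B2) \<union> (D1 \<union> D2)) = {}"
    unfolding T_def using inside_no_overlap by blast
  note ends = arc_between_ends[OF A1] arc_between_ends[OF A2] arc_between_ends[OF B1]
    arc_between_ends[OF B2] arc_between_ends[OF D1] arc_between_ends[OF D2]
    arc_between_ends[OF h1] arc_between_ends[OF h2] arc_between_ends[OF h3]
  have T1: "A1 \<inter> B1 = {a}" "A1 \<inter> B2 = {}" "A2 \<inter> B1 = {}" "A2 \<inter> B2 = {}"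
    using split_sides_meet[OF AB A12 B12] ends by simp_all
  have "A2 \<inter> D1 = {b}" "A2 \<inter> D2 = {}" "A1 \<inter> D1 = {}" "A1 \<inter> D2 = {}"
    using split_sides_meet[of A2 A1 D1 D2 b x z] AD A12 D12 ends by (simp_all add: Un_commute Int_commute)
  moreover have "B2 \<inter> D2 = {c}" "B2 \<inter> D1 = {}" "B1 \<inter> D2 = {}" "B1 \<inter> D1 = {}"
    using split_sides_meet[of B2 B1 D2 D1 c y z] BD B12 D12 ends by (simp_all add: Un_commute Int_commute)
  ultimately have T1: "A1 \<inter> B1 = {a}" "A1 \<inter> B2 = {}" "A1 \<inter> D1 = {}" "A1 \<inter> D2 = {}"
    "A2 \<inter> B1 = {}" "A2 \<inter> B2 = {}" "A2 \<inter> D1 = {b}" "A2 \<inter> D2 = {}"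
    "B1 \<inter> D1 = {}" "B1 \<inter> D2 = {}" "B2 \<inter> D1 = {}" "B2 \<inter> D2 = {c}"
    using T1 by simp_all
  have ptx: "x \<in> A1" "x \<in> A2" "y \<in> B1" "y \<in> B2" "z \<in> D1" "z \<in> D2"
    "x \<in> h1" "x \<in> h2" "y \<in> h1" "y \<in> h3" "z \<in> h2" "z \<in> h3"
    by fact+
  have mem: "x \<notin> B1" "x \<notin> B2" "x \<notin> D1" "x \<notin> D2" "y \<notin> A1" "y \<notin> A2" "y \<notin> D1" "y \<notin> D2"
    "z \<notin> A1" "z \<notin> A2" "z \<notin> B1" "z \<notin> B2"
    using T1 ptx by (metis disjoint_iff)+
  have dist: "x \<noteq> y" "x \<noteq> z" "y \<noteq> z" by fact+
  have memh: "x \<notin> h3" "y \<notin> h2" "z \<notin> h1"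
    using h12 h13 ptx dist by (metis IntI singletonD)+
  have "T \<inter> S = {}" if "S \<subseteq> A1 \<union> A2 \<union> (B1 \<union> B2) \<union> (D1 \<union> D2)" for S
    using TC that by blast
  then have TS: "T \<inter> A1 = {}" "T \<inter> A2 = {}" "T \<inter> B1 = {}" "T \<inter> B2 = {}" "T \<inter> D1 = {}" "T \<inter> D2 = {}"
    by (simp_all add: subset_iff)
  have memT: "x \<notin> T" "y \<notin> T" "z \<notin> T"
    using TS ptx by (metis disjoint_iff)+
  \<comment> \<open>A median runs inside the triangle except at its ends, so it can meet a half side
    only there.\<close>
  have hS0: "h \<inter> S = S \<inter> {u,v}" if "h - {u,v} \<subseteq> T" "u \<in> h" "v \<in> h" "T \<inter> S = {}" for h S u v
    using that by blast
  note hS = hS0[OF h1T ptx(7,9)] hS0[OF h2T ptx(8,11)] hS0[OF h3T ptx(10,12)]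
  have T2: "h1 \<inter> A1 = {x}" "h1 \<inter> A2 = {x}" "h1 \<inter> B1 = {y}" "h1 \<inter> B2 = {y}" "h1 \<inter> D1 = {}" "h1 \<inter> D2 = {}"
    "h2 \<inter> A1 = {x}" "h2 \<inter> A2 = {x}" "h2 \<inter> D1 = {z}" "h2 \<inter> D2 = {z}" "h2 \<inter> B1 = {}" "h2 \<inter> B2 = {}"
    "h3 \<inter> B1 = {y}" "h3 \<inter> B2 = {y}" "h3 \<inter> D1 = {z}" "h3 \<inter> D2 = {z}" "h3 \<inter> A1 = {}" "h3 \<inter> A2 = {}"
    using hS[OF TS(1)] hS[OF TS(2)] hS[OF TS(3)] hS[OF TS(4)] hS[OF TS(5)] hS[OF TS(6)] mem ptx
    by simp_all
  \<comment> \<open>\<open>tab\<close> lists the pairwise intersections of all six half sides and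
    three medians, in both orders. With it the conditions for gluing and cutting below are checked
    by rewriting.\<close>
  note tab0 = T1 T2 A12 B12 D12 h12 h13 h23
  note tab = Int_Un_distrib Int_Un_distrib2 insert_commute tab0 tab0[THEN trans[OF Int_commute]]
  \<comment> \<open>For each cut, \<open>P\<close> is the boundary path around the corner to be cut
    off and \<open>Q\<close> is the rest of the boundary of the current region, both with the ends
    of the cutting median.\<close>
  have P1: "arc_between (A1 \<union> B1) x y"
    using arc_between_join[OF arc_between_sym[OF A1] B1] by (simp add: tab)
  have "arc_between (A2 \<union> D1) x z"
    using arc_between_join[OF A2 D1] by (simp add: tab)
  then have "arc_between (A2 \<union> D1 \<union> D2) x c"
    using arc_between_join[OF _ D2, of "A2 \<union> D1"] by (simp add: tab)
  then have Q1: "arc_between (A2 \<union> D1 \<union> D2 \<union> B2) x y"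
    using arc_between_join[OF _ arc_between_sym[OF B2], of "A2 \<union> D1 \<union> D2"] by (simp add: tab)
  have P2: "arc_between (A2 \<union> D1) x z" by fact
  have "arc_between (h1 \<union> B2) x c"
    using arc_between_join[OF h1 B2] by (simp add: tab)
  then have Q2: "arc_between (h1 \<union> B2 \<union> D2) x z"
    using arc_between_join[OF _ arc_between_sym[OF D2], of "h1 \<union> B2"] by (simp add: tab)
  have P3: "arc_between (B2 \<union> D2) y z"
    using arc_between_join[OF B2 arc_between_sym[OF D2]] by (simp add: tab)
  have Q3: "arc_between (h1 \<union> h2) y z"
    using arc_between_join[OF arc_between_sym[OF h1] h2] by (simp add: tab)
  define Ka where "Ka = inside (A1 \<union> B1 \<union> h1)"
  define N where "N = inside (A2 \<union> D1 \<union> D2 \<union> B2 \<union> h1)"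
  define Kb where "Kb = inside (A2 \<union> D1 \<union> h2)"
  define M where "M = inside (h1 \<union> B2 \<union> D2 \<union> h2)"
  define Kc where "Kc = inside (B2 \<union> D2 \<union> h3)"
  define I where "I = inside (h1 \<union> h2 \<union> h3)"
  have i1: "(A1 \<union> B1) \<inter> (A2 \<union> D1 \<union> D2 \<union> B2) = {x,y}" "(A1 \<union> B1) \<inter> h1 = {x,y}"
    "(A2 \<union> D1 \<union> D2 \<union> B2) \<inter> h1 = {x,y}"
    by (simp_all add: tab)
  have i2: "(A2 \<union> D1) \<inter> (h1 \<union> B2 \<union> D2) = {x,z}" "(A2 \<union> D1) \<inter> h2 = {x,z}"
    "(h1 \<union> B2 \<union> D2) \<inter> h2 = {x,z}"
    by (simp_all add: tab)
  have i3: "(B2 \<union> D2) \<inter> (h1 \<union> h2) = {y,z}" "(B2 \<union> D2) \<inter> h3 = {y,z}"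
    "(h1 \<union> h2) \<inter> h3 = {y,z}"
    by (simp_all add: tab)
  have e1: "A1 \<union> B1 \<union> (A2 \<union> D1 \<union> D2 \<union> B2) = A1 \<union> A2 \<union> (B1 \<union> B2) \<union> (D1 \<union> D2)"
    and e2: "A2 \<union> D1 \<union> (h1 \<union> B2 \<union> D2) = A2 \<union> D1 \<union> D2 \<union> B2 \<union> h1"
    and e3: "B2 \<union> D2 \<union> (h1 \<union> h2) = h1 \<union> B2 \<union> D2 \<union> h2"
    by blast+
  have ne: "h - {u,v} \<noteq> {}" if "arc_between h u v" for h u v
    using arc_between_subset_closure[OF that] arc_between_ends[OF that] by (metis closure_empty empty_iff subsetD)
  have JKa: "Jordan (A1 \<union> B1 \<union> h1)" and JKb: "Jordan (A2 \<union> D1 \<union> h2)"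
    and JKc: "Jordan (B2 \<union> D2 \<union> h3)" and JI: "Jordan (h1 \<union> h2 \<union> h3)"
    and JM: "Jordan (h1 \<union> B2 \<union> D2 \<union> h2)" and JN: "Jordan (A2 \<union> D1 \<union> D2 \<union> B2 \<union> h1)"
    using Jordan_arcs[OF P1 h1 i1(2)] Jordan_arcs[OF P2 h2 i2(2)] Jordan_arcs[OF P3 h3 i3(2)]
      Jordan_arcs[OF Q3 h3 i3(3)] Jordan_arcs[OF Q2 h2 i2(3)] Jordan_arcs[OF Q1 h1 i1(3)] by auto
  have "h1 \<inter> T \<noteq> {}" using ne[OF h1] h1T by blast
  then have s1: "Ka \<inter> N = {}" "Ka \<union> N \<union> (h1 - {x,y}) = T"
    using split_inside_arcs[OF P1 Q1 h1 i1] unfolding e1 Ka_def N_def T_def by auto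
  have cKa: "closure Ka = Ka \<union> (A1 \<union> B1 \<union> h1)"
    unfolding Ka_def using Jordan_closure_inside[OF JKa] by blast
  have opn: "open Ka" "open N" "open Kb" "open M" "open Kc" "open I"
    unfolding Ka_def N_def Kb_def M_def Kc_def I_def
    using Jordan_inside_outside_set(3) JKa JKb JKc JI JM JN by blast+
  \<comment> \<open>Both remaining medians end at \<open>z\<close>, so neither can run in the corner
    \<open>Ka\<close>.\<close>
  have zKa: "z \<notin> closure Ka"
    unfolding cKa using s1(2) memT(3) mem(9,11) memh(3) by blast
  have h2N: "h2 - {x,z} \<subseteq> N"
  proof (rule connected_arc_interior_cases[OF h2 _ opn(1,2) s1(1)])
    show "h2 - {x,z} \<subseteq> Ka \<union> N" using s1(2) h2T h12 by blast
  qed (use zKa in blast)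
  have h3N: "h3 - {y,z} \<subseteq> N"
  proof (rule connected_arc_interior_cases[OF h3 _ opn(1,2) s1(1)])
    show "h3 - {y,z} \<subseteq> Ka \<union> N" using s1(2) h3T h13 by blast
  qed (use zKa in blast)
  have "h2 \<inter> N \<noteq> {}" using ne[OF h2] h2N by blast
  then have s2: "Kb \<inter> M = {}" "Kb \<union> M \<union> (h2 - {x,z}) = N"
    using split_inside_arcs[OF P2 Q2 h2 i2] unfolding e2 Kb_def M_def N_def by auto
  have cKb: "closure Kb = Kb \<union> (A2 \<union> D1 \<union> h2)"
    unfolding Kb_def using Jordan_closure_inside[OF JKb] by blast
  \<comment> \<open>In the same way \<open>h3\<close>, which ends at \<open>y\<close>, cannot run in
    the corner \<open>Kb\<close>.\<close>
  have yKb: "y \<notin> closure Kb"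
    unfolding cKb using s1(2) s2(2) memT(2) mem(6,7) memh(2) by blast
  have h3M: "h3 - {y,z} \<subseteq> M"
  proof (rule connected_arc_interior_cases[OF h3 _ opn(3,4) s2(1)])
    show "h3 - {y,z} \<subseteq> Kb \<union> M" using s2(2) h3N h23 by blast
  qed (use yKb in blast)
  have "h3 \<inter> M \<noteq> {}" using ne[OF h3] h3M by blast
  then have s3: "Kc \<inter> I = {}" "Kc \<union> I \<union> (h3 - {y,z}) = M"
    using split_inside_arcs[OF P3 Q3 h3 i3] unfolding e3 Kc_def I_def M_def by auto
  have cKc: "closure Kc = Kc \<union> (B2 \<union> D2 \<union> h3)"
    unfolding Kc_def using Jordan_closure_inside[OF JKc] by blast
  have no: "Ka \<inter> h1 = {}" "N \<inter> h1 = {}" "Kb \<inter> h2 = {}" "M \<inter> (h1 \<union> h2) = {}" "Kc \<inter> h3 = {}" "I \<inter> h3 = {}"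
    unfolding Ka_def N_def Kb_def M_def Kc_def I_def
    using inside_no_overlap by blast+
  show ?thesis
  proof
    have "Ka \<union> N \<union> Kb \<union> M \<union> Kc \<union> I \<subseteq> T"
      using s1(2) s2(2) s3(2) by blast
    \<comment> \<open>The cutting identities speak of medians without their ends. As the midpoints
      lie in no piece, disjointness extends to the whole medians.\<close>
    with memT have hT: "{x,y,z} \<inter> (Ka \<union> N \<union> Kb \<union> M \<union> Kc \<union> I) = {}"
      by blast
    have "Ka \<inter> (h2 \<union> h3) = {}" using h2N h3N s1(1) hT by blast
    moreover have "Kb \<inter> h1 = {}" using s2(2) no(2) by blast
    moreover have "Kb \<inter> h3 = {}" using s2(1) h3M hT by blast
    moreover have "(Kc \<union> I) \<inter> (h1 \<union> h2) = {}" using s3(2) no(4) by blast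
    ultimately have "(Ka \<union> Kb \<union> Kc \<union> I) \<inter> (h1 \<union> h2 \<union> h3) = {}"
      using no(1,3,5,6) by (simp add: Int_Un_distrib Int_Un_distrib2)
    moreover have "Ka \<union> Kb \<union> Kc \<union> I \<subseteq> T"
      using s1(2) s2(2) s3(2) by blast
    moreover have "T \<subseteq> Ka \<union> Kb \<union> Kc \<union> I \<union> (h1 \<union> h2 \<union> h3)"
      unfolding s1(2)[symmetric] s2(2)[symmetric] s3(2)[symmetric] by blast
    ultimately show "T - (h1 \<union> h2 \<union> h3) = Ka \<union> Kb \<union> Kc \<union> I"
      by blast
    show "connected Ka" "connected Kb"
      unfolding Ka_def Kb_def using Jordan_inside_outside_set(4) JKa JKb by blast+
    show "a \<in> closure Ka" "b \<in> closure Kb"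
      using cKa cKb arc_between_ends(1)[OF A1] arc_between_ends(2)[OF A2] by blast+
    show "x \<notin> closure Kc" unfolding cKc using hT mem(2,4) memh(1) by blast
    show "frontier I \<subseteq> h1 \<union> h2 \<union> h3"
      unfolding I_def using Jordan_inside_outside_set(10)[OF JI] by blast
  qed
qed

section \<open>Plane triangulations\<close>

text \<open>The complement of a set with empty interior is dense, and so its trace on an open set is
  dense there.\<close>

lemma closure_open_avoiding:
  fixes U :: "'a::topological_space set"
  assumes "open U" "interior X = {}"
  shows "closure (U - X) = closure U"
proof
  have "closure (- X) = UNIV"
    using assms(2) by (simp add: closure_complement)
  then have "U \<subseteq> closure (U - X)"
    using open_Int_closure_subset[OF assms(1), of "- X"] by (simp add: Diff_eq)
  then show "closure U \<subseteq> closure (U - X)"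
    by (metis closure_closure closure_mono)
qed (simp add: closure_mono)

lemma interior_UN_closed_empty:
  assumes "finite I" "\<And>i. i \<in> I \<Longrightarrow> closed (S i)" "\<And>i. i \<in> I \<Longrightarrow> interior (S i) = {}"
  shows "interior (\<Union>i\<in>I. S i) = {}"
  using assms
proof (induction I rule: finite_induct)
  case (insert i I)
  then show ?case
    using interior_closed_Un_empty_interior[of "S i" "\<Union>i\<in>I. S i"] by simp
qed simp

lemma plane_embedding_arc:
  assumes "plane_embedding V E p g" "e \<in> E"
  shows "arc (g e)" "{pathstart (g e), pathfinish (g e)} = p ` e" "path_image (g e) \<inter> p ` V = p ` e"
  using assms unfolding plane_embedding_def by blast+

lemma plane_embedding_meet:
  assumes "plane_embedding V E p g" "e \<in> E" "e' \<in> E" "e \<noteq> e'"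
  shows "path_image (g e) \<inter> path_image (g e') \<subseteq> p ` (e \<inter> e')"
  using assms unfolding plane_embedding_def by blast

lemma closed_drawing:
  assumes "plane_embedding V E p g" "finite V" "finite E"
  shows "closed (drawing V E p g)"
proof -
  have "closed (path_image (g e))" if "e \<in> E" for e
    using plane_embedding_arc(1)[OF assms(1) that] by (rule closed_arc_image)
  then show ?thesis
    unfolding drawing_def using assms(2,3)
    by (intro closed_Un closed_UN finite_imp_closed finite_imageI) auto
qed

section \<open>Edges, midpoints and triangles\<close>

locale conjugated =
  fixes V :: "'a set" and E :: "'a set set"
    and p :: "'a \<Rightarrow> complex" and g :: "'a set \<Rightarrow> real \<Rightarrow> complex"
    and m :: "'a set set \<Rightarrow> real \<Rightarrow> complex"
  assumes tri: "plane_triangulation V E p g"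
    and conj: "conjugated_triangulation V E p g m"
begin

abbreviation S :: "'a \<Rightarrow> 'a \<Rightarrow> complex set" where
  "S u v \<equiv> path_image (g {u, v})"

abbreviation mid :: "'a set \<Rightarrow> complex" where
  "mid \<equiv> edge_midpoint g"

definition triangle :: "'a \<Rightarrow> 'a \<Rightarrow> 'a \<Rightarrow> bool" where
  "triangle a b c \<longleftrightarrow> a \<noteq> b \<and> b \<noteq> c \<and> a \<noteq> c \<and> {a, b} \<in> E \<and> {b, c} \<in> E \<and> {a, c} \<in> E"

abbreviation L where "L \<equiv> drawing V E p g"
abbreviation H where "H \<equiv> drawing E (conj_edges V E p g) mid m"

lemma emb: "plane_embedding V E p g"
  using tri unfolding plane_triangulation_def by blast

lemma conj_emb: "plane_embedding E (conj_edges V E p g) mid m"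
  using conj unfolding conjugated_triangulation_def by blast

lemma simple: "simple_graph V E"
  using tri unfolding plane_triangulation_def maximal_planar_def by blast

lemma finite_V: "finite V"
  using simple unfolding simple_graph_def by blast

lemma edge_subset: "e \<in> E \<Longrightarrow> e \<subseteq> V"
  using simple unfolding simple_graph_def by blast

lemma finite_E: "finite E"
  using finite_subset[of E "Pow V"] finite_V edge_subset by blast

lemma edge_cases:
  assumes "e \<in> E"
  obtains a b where "e = {a, b}" "a \<noteq> b"
  using assms simple unfolding simple_graph_def by (metis card_2_iff)

lemma edge_distinct: "{u, v} \<in> E \<Longrightarrow> u \<noteq> v"
  using simple unfolding simple_graph_def by fastforce

lemma edge_vertices: "{u, v} \<in> E \<Longrightarrow> u \<in> V \<and> v \<in> V"
  using edge_subset by blast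

lemmas edge_arc = plane_embedding_arc[OF emb]
lemmas edges_meet = plane_embedding_meet[OF emb]

text \<open>An edge is an unordered pair while \<open>g\<close> chooses a direction for its arc, so
  the halves are swapped when the arc starts at \<open>p v\<close>.\<close>

lemma half_edges:
  assumes e: "{u, v} \<in> E"
  obtains A B where "S u v = A \<union> B" "A \<inter> B = {mid {u, v}}"
    "arc_between A (p u) (mid {u, v})" "arc_between B (mid {u, v}) (p v)"
proof -
  obtain A B where AB: "S u v = A \<union> B" "A \<inter> B = {mid {u, v}}"
    "arc_between A (pathstart (g {u, v})) (mid {u, v})" "arc_between B (mid {u, v}) (pathfinish (g {u, v}))"
    unfolding edge_midpoint_def using arc_split_half[OF edge_arc(1)[OF e]] .
  have "{pathstart (g {u, v}), pathfinish (g {u, v})} = {p u, p v}"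
    using edge_arc(2)[OF e] by simp
  then consider "pathstart (g {u, v}) = p u" "pathfinish (g {u, v}) = p v"
    | "pathstart (g {u, v}) = p v" "pathfinish (g {u, v}) = p u"
    by (auto simp: doubleton_eq_iff)
  then show ?thesis
  proof cases
    case 1
    then show ?thesis using that AB by simp
  next
    case 2
    then show ?thesis
      using that[of B A] AB arc_between_sym by (metis Int_commute Un_commute)
  qed
qed

lemma edge_arc_between:
  assumes "{u, v} \<in> E"
  shows "arc_between (S u v) (p u) (p v)"
proof -
  obtain A B where "S u v = A \<union> B" "A \<inter> B = {mid {u, v}}"
    "arc_between A (p u) (mid {u, v})" "arc_between B (mid {u, v}) (p v)"
    using half_edges[OF assms] .
  then show ?thesis using arc_between_join by metis
qed

lemma mid_in_edge: "mid e \<in> path_image (g e)"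
  unfolding edge_midpoint_def path_image_def by auto

text \<open>An edge passes through no vertices but its ends, and the midpoint is joined to each end
  by an arc, so it differs from both.\<close>

lemma mid_not_vertex:
  assumes "e \<in> E"
  shows "mid e \<notin> p ` V"
proof
  assume *: "mid e \<in> p ` V"
  obtain a b where e: "e = {a, b}" using edge_cases[OF assms] .
  have "mid e \<in> {p a, p b}"
    using * mid_in_edge edge_arc(3)[OF assms] e by blast
  moreover obtain A B where "arc_between A (p a) (mid e)" "arc_between B (mid e) (p b)"
    using half_edges[of a b] assms e by metis
  ultimately show False by (metis arc_between_ends(3) insertE singletonD)
qed

text \<open>Distinct edges meet only in vertices. Midpoints can therefore serve as markers that
  identify their edges.\<close>

lemma mid_in_edge_unique:
  assumes "e \<in> E" "e' \<in> E" "mid e \<in> path_image (g e')"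
  shows "e = e'"
proof (rule ccontr)
  assume "e \<noteq> e'"
  then have "mid e \<in> p ` (e \<inter> e')"
    using edges_meet[OF assms(1,2)] mid_in_edge assms(3) by blast
  then show False
    using mid_not_vertex[OF assms(1)] edge_subset[OF assms(1)] by blast
qed

lemma adjacent_edges_meet:
  assumes "{u, v} \<in> E" "{u, w} \<in> E" "v \<noteq> w"
  shows "S u v \<inter> S u w = {p u}"
proof
  have "{u, v} \<noteq> {u, w}" "{u, v} \<inter> {u, w} = {u}"
    using assms edge_distinct[OF assms(1)] by (auto simp: doubleton_eq_iff)
  then show "S u v \<inter> S u w \<subseteq> {p u}"
    using edges_meet[OF assms(1,2)] by auto
  show "{p u} \<subseteq> S u v \<inter> S u w"
    using edge_arc_between assms arc_between_ends(1) by blast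
qed

lemma triangle_sides_meet:
  assumes "triangle a b c"
  shows "S a b \<inter> S a c = {p a}" "S a b \<inter> S b c = {p b}" "S a c \<inter> S b c = {p c}"
  using assms adjacent_edges_meet[of a b c] adjacent_edges_meet[of b a c] adjacent_edges_meet[of c a b]
  unfolding triangle_def by (simp_all add: insert_commute)

lemma two_sides_arc:
  assumes "triangle a b c"
  shows "arc_between (S a c \<union> S b c) (p a) (p b)" "S a b \<inter> (S a c \<union> S b c) = {p a, p b}"
proof -
  have "arc_between (S a c) (p a) (p c)" "arc_between (S b c) (p c) (p b)"
    using assms edge_arc_between arc_between_sym unfolding triangle_def by blast+
  then show "arc_between (S a c \<union> S b c) (p a) (p b)"
    using arc_between_join triangle_sides_meet(3)[OF assms] by blast
  show "S a b \<inter> (S a c \<union> S b c) = {p a, p b}"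
    using triangle_sides_meet(1,2)[OF assms] by (simp add: Int_Un_distrib insert_commute)
qed

lemma Jordan_triangle:
  assumes "triangle a b c"
  shows "Jordan (S a b \<union> (S a c \<union> S b c))"
  using Jordan_arcs[OF edge_arc_between two_sides_arc[OF assms]] assms
  unfolding triangle_def by blast

section \<open>Faces of the triangulation\<close>

lemma L_closed: "closed L"
  using closed_drawing emb finite_V finite_E by blast

lemma L_interior: "interior L = {}"
proof -
  have "interior (\<Union>e\<in>E. path_image (g e)) = {}"
    using edge_arc(1) closed_arc_image interior_arc_image_empty
    by (intro interior_UN_closed_empty finite_E) blast+
  moreover have "closed (p ` V)" "interior (p ` V) = {}"
    using finite_V by (simp_all add: finite_imp_closed empty_interior_finite)
  ultimately show ?thesis
    unfolding drawing_def using interior_closed_Un_empty_interior by metis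
qed

lemma face:
  assumes "F \<in> faces V E p g"
  shows "open F" "connected F" "F \<noteq> {}" "F \<inter> L = {}"
proof -
  have F: "F \<in> components (- L)" using assms unfolding faces_def .
  show "open F"
    using open_components[OF _ F] L_closed by blast
  show "connected F" "F \<noteq> {}" "F \<inter> L = {}"
    using in_components_connected[OF F] in_components_nonempty[OF F] in_components_subset[OF F] by auto
qed

lemma faces_eq_if_meet:
  "\<lbrakk>F \<in> faces V E p g; G \<in> faces V E p g; F \<inter> G \<noteq> {}\<rbrakk> \<Longrightarrow> F = G"
  unfolding faces_def using components_eq by blast

lemma vertex_in_L: "v \<in> V \<Longrightarrow> p v \<in> L" and edge_in_L: "e \<in> E \<Longrightarrow> path_image (g e) \<subseteq> L"
  unfolding drawing_def by auto

lemma face_triangle: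
  assumes "F \<in> faces V E p g"
  obtains a b c where "triangle a b c" "frontier F = S a b \<union> (S a c \<union> S b c)"
proof -
  have "triangular_face E g F"
    using tri assms unfolding plane_triangulation_def by blast
  then obtain a b c where "triangle a b c" "frontier F = S a b \<union> S b c \<union> S a c"
    unfolding triangular_face_def triangle_def by blast
  then show ?thesis using that by (simp add: Un_ac)
qed

lemma face_side_of_triangle:
  assumes "F \<in> faces V E p g" "triangle a b c" "frontier F = S a b \<union> (S a c \<union> S b c)"
  shows "F = inside (frontier F) \<or> F = outside (frontier F)"
  using component_of_Jordan_complement[OF Jordan_triangle[OF assms(2)]] face[OF assms(1)] assms(3) by auto

lemma bounded_face_inside:
  assumes "F \<in> faces V E p g" "triangle a b c" "frontier F = S a b \<union> (S a c \<union> S b c)" "bounded F"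
  shows "F = inside (S a b \<union> (S a c \<union> S b c))"
  using face_side_of_triangle[OF assms(1-3)] Jordan_inside_outside_set(9)[OF Jordan_triangle[OF assms(2)]]
    assms(3,4) by auto

text \<open>A face is the inside or the outside of the curve drawn by some set of edges, and
  \<open>E\<close> has finitely many subsets.\<close>

lemma finite_faces: "finite (faces V E p g)"
proof -
  let ?C = "(\<lambda>D. \<Union>e\<in>D. path_image (g e)) ` Pow E"
  have "F \<in> inside ` ?C \<union> outside ` ?C" if F: "F \<in> faces V E p g" for F
  proof -
    obtain a b c where abc: "triangle a b c" "frontier F = S a b \<union> (S a c \<union> S b c)"
      using face_triangle[OF F] .
    then have "frontier F = (\<Union>e\<in>{{a, b}, {a, c}, {b, c}}. path_image (g e))" by simp
    then have "frontier F \<in> ?C"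
      using abc(1) unfolding triangle_def by blast
    then show ?thesis using face_side_of_triangle[OF F abc] by blast
  qed
  then show ?thesis
    using finite_E by (meson finite_Pow_iff finite_UnI finite_imageI finite_subset subsetI)
qed

text \<open>Off \<open>L\<close>, which has empty interior, the set \<open>U\<close> is dense in
  itself and is covered by the faces. As there are finitely many faces, the closures of their traces
  have a closed union, so one of them contains \<open>x\<close>.\<close>

lemma near_face:
  assumes "open U" "x \<in> closure U"
  obtains F where "F \<in> faces V E p g" "x \<in> closure (U \<inter> F)"
proof -
  have "\<Union>(faces V E p g) = - L"
    unfolding faces_def by (simp add: Union_components)
  then have "U - L = (\<Union>F\<in>faces V E p g. U \<inter> F)" by blast
  also have "\<dots> \<subseteq> (\<Union>F\<in>faces V E p g. closure (U \<inter> F))"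
    by (intro UN_mono closure_subset) simp
  finally have "U - L \<subseteq> (\<Union>F\<in>faces V E p g. closure (U \<inter> F))" .
  moreover have "closed (\<Union>F\<in>faces V E p g. closure (U \<inter> F))"
    using finite_faces by (intro closed_UN) auto
  ultimately have "closure (U - L) \<subseteq> (\<Union>F\<in>faces V E p g. closure (U \<inter> F))"
    by (rule closure_minimal)
  then have "closure U \<subseteq> (\<Union>F\<in>faces V E p g. closure (U \<inter> F))"
    unfolding closure_open_avoiding[OF assms(1) L_interior] .
  then show ?thesis using assms(2) that by blast
qed

text \<open>The midpoint lies on the boundary triangle of the face and on no edge other than
  \<open>{a, b}\<close>, so that edge is a side. The six cases relabel the corners.\<close>

lemma face_at_edge:
  assumes "F \<in> faces V E p g" "{a, b} \<in> E" "mid {a, b} \<in> closure F"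
  obtains c where "triangle a b c" "frontier F = S a b \<union> (S a c \<union> S b c)"
proof -
  have "mid {a, b} \<notin> F"
    using face(4)[OF assms(1)] edge_in_L[OF assms(2)] mid_in_edge by blast
  then have x: "mid {a, b} \<in> frontier F"
    using assms(3) face(1)[OF assms(1)] by (simp add: frontier_def interior_open)
  obtain u v w where t: "triangle u v w" "frontier F = S u v \<union> (S u w \<union> S v w)"
    using face_triangle[OF assms(1)] .
  then have "{a, b} = {u, v} \<or> {a, b} = {u, w} \<or> {a, b} = {v, w}"
    using x mid_in_edge_unique[OF assms(2)] unfolding triangle_def by blast
  then consider "a = u" "b = v" | "a = v" "b = u" | "a = u" "b = w" | "a = w" "b = u"
    | "a = v" "b = w" | "a = w" "b = v"
    by (auto simp: doubleton_eq_iff)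
  then show ?thesis
    by cases (use t that[of u] that[of v] that[of w] in \<open>auto simp: triangle_def insert_commute Un_ac\<close>)
qed

lemma boundary_edges_triangle:
  assumes "triangle a b c" "frontier F = S a b \<union> (S a c \<union> S b c)"
  shows "boundary_edges E g F = {{a, b}, {a, c}, {b, c}}"
proof
  show "boundary_edges E g F \<subseteq> {{a, b}, {a, c}, {b, c}}"
  proof
    fix e assume "e \<in> boundary_edges E g F"
    then have "e \<in> E" "mid e \<in> S a b \<union> (S a c \<union> S b c)"
      using assms(2) mid_in_edge unfolding boundary_edges_def by blast+
    then show "e \<in> {{a, b}, {a, c}, {b, c}}"
      using mid_in_edge_unique assms(1) unfolding triangle_def by blast
  qed
  show "{{a, b}, {a, c}, {b, c}} \<subseteq> boundary_edges E g F"
    using assms unfolding boundary_edges_def triangle_def by auto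
qed

lemma boundary_edge_mid:
  "e \<in> boundary_edges E g F \<Longrightarrow> mid e \<in> closure F"
  using mid_in_edge unfolding boundary_edges_def frontier_def by blast

text \<open>One face \<open>F\<close> near the midpoint is a full side of its boundary triangle. The
  other side has the same frontier, so a second face approaches the midpoint from there.\<close>

lemma two_faces_at_edge:
  assumes "e \<in> E"
  obtains F G where "F \<in> faces V E p g" "G \<in> faces V E p g" "F \<noteq> G"
    "mid e \<in> closure F" "mid e \<in> closure G"
proof -
  obtain F where F: "F \<in> faces V E p g" "mid e \<in> closure (UNIV \<inter> F)"
    using near_face[of UNIV "mid e"] by auto
  obtain a b where e: "e = {a, b}" using edge_cases[OF assms] .
  obtain c where c: "triangle a b c" "frontier F = S a b \<union> (S a c \<union> S b c)"
    using face_at_edge[of F a b] F assms e by auto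
  note J = Jordan_inside_outside_set[OF Jordan_triangle[OF c(1)]]
  have x: "mid e \<in> frontier F" using c(2) mid_in_edge e by blast
  \<comment> \<open>\<open>U\<close> is the opposite side of the triangle: the outside if
    \<open>F\<close> is the inside, and conversely.\<close>
  obtain U where U: "open U" "U \<inter> F = {}" "frontier U = frontier F"
    using face_side_of_triangle[OF F(1) c] J(3,6,10,11) c(2) inside_Int_outside
    by (metis Int_commute)
  then obtain G where G: "G \<in> faces V E p g" "mid e \<in> closure (U \<inter> G)"
    using near_face[of U "mid e"] x unfolding frontier_def by blast
  then have "U \<inter> G \<noteq> {}" by auto
  then have "F \<noteq> G" using U(2) by blast
  moreover have "mid e \<in> closure G"
    using G(2) closure_mono[of "U \<inter> G" G] by blast
  ultimately show ?thesis using that F G(1) by simp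
qed

text \<open>The edge is the middle arc of a theta graph whose outer arcs run through
  \<open>c\<close> and \<open>d\<close>. Its midpoint lies in the open inside of the outer curve,
  which is covered by \<open>F\<close>, \<open>G\<close> and the edge. A face that comes close to
  the midpoint must then meet \<open>F\<close> or \<open>G\<close>.\<close>

lemma face_at_edge_cases:
  assumes e: "{a, b} \<in> E" and "c \<noteq> d"
    and F: "F \<in> faces V E p g" "bounded F" "triangle a b c" "frontier F = S a b \<union> (S a c \<union> S b c)"
    and G: "G \<in> faces V E p g" "bounded G" "triangle a b d" "frontier G = S a b \<union> (S a d \<union> S b d)"
    and K: "K \<in> faces V E p g" "mid {a, b} \<in> closure K"
  shows "K = F \<or> K = G"
proof -
  let ?P = "S a c \<union> S b c" and ?Q = "S a d \<union> S b d"
  have ed: "{a, c} \<in> E" "{b, c} \<in> E" "{a, d} \<in> E" "{b, d} \<in> E" "a \<noteq> b" "a \<noteq> c" "b \<noteq> c" "a \<noteq> d" "b \<noteq> d"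
    using F(3) G(3) unfolding triangle_def by blast+
  have Fi: "F = inside (S a b \<union> ?P)" and Gi: "G = inside (S a b \<union> ?Q)"
    using bounded_face_inside F G by blast+
  have "{a, c} \<inter> {b, d} = {}" "{b, c} \<inter> {a, d} = {}"
    using ed \<open>c \<noteq> d\<close> by auto
  then have "S a c \<inter> S b d = {}" "S b c \<inter> S a d = {}"
    using edges_meet[of "{a, c}" "{b, d}"] edges_meet[of "{b, c}" "{a, d}"] ed \<open>c \<noteq> d\<close> by auto
  moreover have "S a c \<inter> S a d = {p a}" "S b c \<inter> S b d = {p b}"
    using adjacent_edges_meet ed \<open>c \<noteq> d\<close> by auto
  ultimately have PQ: "?P \<inter> ?Q = {p a, p b}"
    by (simp add: Int_Un_distrib Int_Un_distrib2 insert_commute)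
  note th = edge_arc_between[OF e] two_sides_arc(1)[OF F(3)] two_sides_arc(1)[OF G(3)]
    two_sides_arc(2)[OF F(3)] two_sides_arc(2)[OF G(3)] PQ
  have "?P \<subseteq> L" "?Q \<subseteq> L"
    using edge_in_L ed by blast+
  \<comment> \<open>Faces avoid all edges; this supplies the two disjointness conditions of
    \<open>theta_middle_inside\<close>.\<close>
  then have "F \<inter> ?Q = {}" "G \<inter> ?P = {}"
    using face(4)[OF F(1)] face(4)[OF G(1)] by blast+
  then have "S a b - {p a, p b} \<subseteq> inside (?P \<union> ?Q)"
    using theta_middle_inside[OF th] Fi Gi by blast
  moreover have "mid {a, b} \<notin> {p a, p b}"
    using mid_not_vertex[OF e] edge_vertices[OF e] by blast
  ultimately have "mid {a, b} \<in> inside (?P \<union> ?Q)"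
    using mid_in_edge by blast
  moreover have "open (inside (?P \<union> ?Q))"
    using Jordan_inside_outside_set(3)[OF Jordan_arcs[OF th(2,3,6)]] .
  ultimately have "inside (?P \<union> ?Q) \<inter> K \<noteq> {}"
    using K(2) open_Int_closure_eq_empty by blast
  moreover have "inside (?P \<union> ?Q) \<subseteq> F \<union> G \<union> S a b"
    using theta_inside_subset[OF th] Fi Gi by blast
  moreover have "K \<inter> S a b = {}"
    using face(4)[OF K(1)] edge_in_L[OF e] by blast
  ultimately have "K \<inter> F \<noteq> {} \<or> K \<inter> G \<noteq> {}" by blast
  then show ?thesis using faces_eq_if_meet F(1) G(1) K(1) by blast
qed

section \<open>Medians and the drawing of the conjugated triangulation\<close>

lemma conj_edgeE:
  assumes "d \<in> conj_edges V E p g"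
  obtains e e' F where "d = {e, e'}" "e \<noteq> e'" "F \<in> faces V E p g" "bounded F"
    "e \<in> boundary_edges E g F" "e' \<in> boundary_edges E g F"
  using assms unfolding conj_edges_def by blast

lemma conj_edgeI:
  assumes "F \<in> faces V E p g" "bounded F" "e \<in> boundary_edges E g F" "e' \<in> boundary_edges E g F" "e \<noteq> e'"
  shows "{e, e'} \<in> conj_edges V E p g"
  using assms unfolding conj_edges_def by blast

lemma median_in_face:
  assumes "F \<in> faces V E p g" "bounded F" "e \<in> boundary_edges E g F" "e' \<in> boundary_edges E g F" "e \<noteq> e'"
  shows "path_image (m {e, e'}) - {mid e, mid e'} \<subseteq> F"
  using conj assms unfolding conjugated_triangulation_def by blast

lemma median_arc:
  assumes "{e, e'} \<in> conj_edges V E p g"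
  shows "arc_between (path_image (m {e, e'})) (mid e) (mid e')"
proof -
  have "arc (m {e, e'})" "{pathstart (m {e, e'}), pathfinish (m {e, e'})} = {mid e, mid e'}"
    using plane_embedding_arc(1,2)[OF conj_emb assms] by simp_all
  then have "arc_between (path_image (m {e, e'})) (mid e) (mid e')
      \<or> arc_between (path_image (m {e, e'})) (mid e') (mid e)"
    unfolding arc_between_def by (metis doubleton_eq_iff)
  then show ?thesis using arc_between_sym by blast
qed

lemma medians_meet:
  assumes "{e, e'} \<in> conj_edges V E p g" "{e, e''} \<in> conj_edges V E p g" "e' \<noteq> e''"
  shows "path_image (m {e, e'}) \<inter> path_image (m {e, e''}) = {mid e}"
proof
  have ne: "e \<noteq> e'" using arc_between_ends(3)[OF median_arc[OF assms(1)]] by blast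
  then have "{e, e'} \<noteq> {e, e''}" "{e, e'} \<inter> {e, e''} = {e}"
    using assms(3) by (auto simp: doubleton_eq_iff)
  moreover have "path_image (m {e, e'}) \<inter> path_image (m {e, e''}) \<subseteq> mid ` ({e, e'} \<inter> {e, e''})"
    using plane_embedding_meet[OF conj_emb assms(1,2)] \<open>{e, e'} \<noteq> {e, e''}\<close> by blast
  ultimately show "path_image (m {e, e'}) \<inter> path_image (m {e, e''}) \<subseteq> {mid e}"
    by auto
  show "{mid e} \<subseteq> path_image (m {e, e'}) \<inter> path_image (m {e, e''})"
    using median_arc assms arc_between_ends(1) by blast
qed

lemma mid_in_L: "e \<in> E \<Longrightarrow> mid e \<in> L"
  using mid_in_edge edge_in_L by blast

lemma H_cases:
  assumes "y \<in> H" "y \<notin> mid ` E"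
  obtains e e' F where "F \<in> faces V E p g" "bounded F" "y \<in> F"
    "e \<in> boundary_edges E g F" "e' \<in> boundary_edges E g F" "e \<noteq> e'" "y \<in> path_image (m {e, e'})"
proof -
  obtain d where d: "d \<in> conj_edges V E p g" "y \<in> path_image (m d)"
    using assms unfolding drawing_def by blast
  obtain e e' F where e: "d = {e, e'}" "e \<noteq> e'" "F \<in> faces V E p g" "bounded F"
    "e \<in> boundary_edges E g F" "e' \<in> boundary_edges E g F"
    using conj_edgeE[OF d(1)] .
  have "mid e \<in> mid ` E" "mid e' \<in> mid ` E"
    using e(5,6) unfolding boundary_edges_def by auto
  then have "y \<notin> {mid e, mid e'}" using assms(2) by auto
  then have "y \<in> F"
    using median_in_face[OF e(3-6,2)] d(2) e(1) by blast
  then show ?thesis using that e d by blast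
qed

text \<open>Midpoints lie on \<open>L\<close>, so a point of \<open>H\<close> in a face is an inner
  point of a median. That median belongs to the same face, since distinct faces are
  disjoint.\<close>

lemma H_in_face:
  assumes "y \<in> H" "y \<in> F" "F \<in> faces V E p g"
  obtains e e' where "bounded F"
    "e \<in> boundary_edges E g F" "e' \<in> boundary_edges E g F" "e \<noteq> e'" "y \<in> path_image (m {e, e'})"
proof -
  have "y \<notin> mid ` E" using face(4)[OF assms(3)] assms(2) mid_in_L by blast
  then obtain e e' G where "G \<in> faces V E p g" "bounded G" "y \<in> G"
    "e \<in> boundary_edges E g G" "e' \<in> boundary_edges E g G" "e \<noteq> e'" "y \<in> path_image (m {e, e'})"
    using H_cases[OF assms(1)] by metis
  moreover from this have "G = F" using faces_eq_if_meet assms by blast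
  ultimately show ?thesis using that by blast
qed

lemma unbounded_face_disjoint_H:
  assumes "F \<in> faces V E p g" "\<not> bounded F"
  shows "F \<inter> H = {}"
proof (rule ccontr)
  assume "F \<inter> H \<noteq> {}"
  then obtain y where "y \<in> H" "y \<in> F" by blast
  then show False using H_in_face[OF _ _ assms(1)] assms(2) by metis
qed

text \<open>Apart from the midpoints, \<open>H\<close> runs inside faces. The vertices of
  \<open>L\<close> are thus passages from one face to another that avoid \<open>H\<close>.\<close>

lemma vertex_not_in_H:
  assumes "v \<in> V"
  shows "p v \<notin> H"
proof
  assume "p v \<in> H"
  moreover have "p v \<notin> mid ` E" using mid_not_vertex assms by force
  ultimately obtain F where "F \<in> faces V E p g" "p v \<in> F" using H_cases by metis
  then show False using face(4) vertex_in_L[OF assms] by blast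
qed

lemma H_closed: "closed H"
proof -
  have "finite (conj_edges V E p g)"
    by (rule finite_subset[of _ "Pow E"])
      (use finite_E in \<open>auto simp: conj_edges_def boundary_edges_def\<close>)
  then show ?thesis using closed_drawing conj_emb finite_E by blast
qed

section \<open>Faces of the second class\<close>

text \<open>If \<open>W\<close> were unbounded, \<open>K\<close> could not meet the corners at the
  ends of \<open>e\<close> or the central piece of the face \<open>T\<close> through which it
  approaches the midpoint. Only the corner opposite to \<open>e\<close> would remain, and its
  closure misses the midpoint.\<close>

lemma second_class_edge_not_outer:
  assumes K: "second_class_face V E p g m K" and e: "e \<in> E" "mid e \<in> frontier K"
    and W: "W \<in> faces V E p g" "mid e \<in> closure W"
  shows "bounded W"
proof (rule ccontr)
  assume unb: "\<not> bounded W"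
  have KH: "K \<in> components (- H)" and "bounded K"
    using K unfolding second_class_face_def conj_faces_def faces_def by auto
  obtain v where v: "v \<in> V" "p v \<in> K"
    using K interior_subset unfolding second_class_face_def by blast
  have "open K" using open_components[OF _ KH] H_closed by blast
  have KnH: "K \<inter> H = {}" using in_components_subset[OF KH] by blast
  have "connected K" using in_components_connected[OF KH] .
  \<comment> \<open>\<open>K\<close> is a component off \<open>H\<close>, so it would swallow any
    connected set off \<open>H\<close> that it meets, while \<open>K\<close> itself is
    bounded.\<close>
  have no_escape: "K \<inter> Z = {}" if "connected Z" "Z \<inter> H = {}" "\<not> bounded Z" for Z
    using components_maximal[OF KH that(1)] that(2,3) \<open>bounded K\<close> bounded_subset by blast
  have WnH: "W \<inter> H = {}"
    using unbounded_face_disjoint_H[OF W(1) unb] .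
  have "mid e \<in> closure K" using e(2) unfolding frontier_def by blast
  then obtain T where T: "T \<in> faces V E p g" "mid e \<in> closure (K \<inter> T)"
    using near_face[OF \<open>open K\<close>] by blast
  have xT: "mid e \<in> closure T" using T(2) closure_mono[of "K \<inter> T" T] by blast
  have "K \<inter> T \<noteq> {}" using T(2) by auto
  have bT: "bounded T"
  proof (rule ccontr)
    assume "\<not> bounded T"
    moreover from this have "T \<inter> H = {}" by (rule unbounded_face_disjoint_H[OF T(1)])
    ultimately show False using no_escape[of T] face(2)[OF T(1)] \<open>K \<inter> T \<noteq> {}\<close> by blast
  qed
  obtain a b where ab: "e = {a, b}" using edge_cases[OF e(1)] .
  obtain c where c: "triangle a b c" and fT: "frontier T = S a b \<union> (S a c \<union> S b c)"
    using face_at_edge[OF T(1)] xT e(1) ab by metis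
  have ed: "{a, b} \<in> E" "{a, c} \<in> E" "{b, c} \<in> E" and dist: "a \<noteq> b" "a \<noteq> c" "b \<noteq> c"
    using c unfolding triangle_def by auto
  have Ti: "T = inside (S a b \<union> (S a c \<union> S b c))"
    using bounded_face_inside[OF T(1) c fT bT] .
  obtain A1 A2 where A: "S a b = A1 \<union> A2" "A1 \<inter> A2 = {mid {a, b}}"
    "arc_between A1 (p a) (mid {a, b})" "arc_between A2 (mid {a, b}) (p b)"
    using half_edges[OF ed(1)] .
  obtain B1 B2 where B: "S a c = B1 \<union> B2" "B1 \<inter> B2 = {mid {a, c}}"
    "arc_between B1 (p a) (mid {a, c})" "arc_between B2 (mid {a, c}) (p c)"
    using half_edges[OF ed(2)] .
  obtain D1 D2 where D: "S b c = D1 \<union> D2" "D1 \<inter> D2 = {mid {b, c}}"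
    "arc_between D1 (p b) (mid {b, c})" "arc_between D2 (mid {b, c}) (p c)"
    using half_edges[OF ed(3)] .
  have Ti': "T = inside (A1 \<union> A2 \<union> (B1 \<union> B2) \<union> (D1 \<union> D2))"
    using Ti unfolding A(1) B(1) D(1) by (simp add: Un_assoc)
  let ?h1 = "path_image (m {{a, b}, {a, c}})" and ?h2 = "path_image (m {{a, b}, {b, c}})"
    and ?h3 = "path_image (m {{a, c}, {b, c}})"
  have be: "boundary_edges E g T = {{a, b}, {a, c}, {b, c}}"
    using boundary_edges_triangle[OF c fT] .
  have ne: "{a, b} \<noteq> {a, c}" "{a, b} \<noteq> {b, c}" "{a, c} \<noteq> {b, c}"
    using dist by (auto simp: doubleton_eq_iff)
  have ce: "{{a, b}, {a, c}} \<in> conj_edges V E p g" "{{a, b}, {b, c}} \<in> conj_edges V E p g"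
    "{{a, c}, {b, c}} \<in> conj_edges V E p g"
    using conj_edgeI[OF T(1) bT] be ne by auto
  have hT: "?h1 - {mid {a, b}, mid {a, c}} \<subseteq> T" "?h2 - {mid {a, b}, mid {b, c}} \<subseteq> T"
    "?h3 - {mid {a, c}, mid {b, c}} \<subseteq> T"
    using median_in_face[OF T(1) bT] be ne by blast+
  have hh: "?h1 \<inter> ?h2 = {mid {a, b}}" "?h1 \<inter> ?h3 = {mid {a, c}}" "?h2 \<inter> ?h3 = {mid {b, c}}"
    using medians_meet[of "{a, b}" "{a, c}" "{b, c}"] medians_meet[of "{a, c}" "{a, b}" "{b, c}"]
      medians_meet[of "{b, c}" "{a, b}" "{a, c}"] ce ne by (simp_all add: insert_commute)
  obtain Ka Kb Kc I where R: "T - (?h1 \<union> ?h2 \<union> ?h3) = Ka \<union> Kb \<union> Kc \<union> I"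
    and cK: "connected Ka" "connected Kb" and cl: "p a \<in> closure Ka" "p b \<in> closure Kb"
    and xKc: "mid {a, b} \<notin> closure Kc" and fI: "frontier I \<subseteq> ?h1 \<union> ?h2 \<union> ?h3"
    using medians_split_triangle[OF A(3,4,2) B(3,4,2) D(3,4,2)
        triangle_sides_meet[OF c, unfolded A(1) B(1) D(1)] median_arc[OF ce(1)] median_arc[OF ce(2)]
        median_arc[OF ce(3)] hT[unfolded Ti'] hh, folded Ti'] .
  have hH: "?h1 \<union> ?h2 \<union> ?h3 \<subseteq> H"
    using ce unfolding drawing_def by blast
  \<comment> \<open>Medians of other faces do not enter \<open>T\<close>, so within \<open>T\<close>
    only the three medians matter.\<close>
  have HT: "T \<inter> H \<subseteq> ?h1 \<union> ?h2 \<union> ?h3"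
  proof
    fix y assume "y \<in> T \<inter> H"
    then have "y \<in> H" "y \<in> T" by blast+
    then obtain f f' where "f \<in> boundary_edges E g T" "f' \<in> boundary_edges E g T" "f \<noteq> f'"
      "y \<in> path_image (m {f, f'})"
      using T(1) by (rule H_in_face)
    then show "y \<in> ?h1 \<union> ?h2 \<union> ?h3"
      unfolding be by (auto simp: insert_commute)
  qed
  obtain d where "frontier W = S a b \<union> (S a d \<union> S b d)"
    using face_at_edge[OF W(1)] W(2) e(1) ab by metis
  then have "S a b \<subseteq> closure W" unfolding frontier_def by blast
  then have cW: "p a \<in> closure W" "p b \<in> closure W"
    using edge_arc_between[OF ed(1)] arc_between_ends by blast+
  \<comment> \<open>The point \<open>p w\<close> is a limit of both \<open>Q\<close> and
    \<open>W\<close> and lies off \<open>H\<close>. Adding it glues them into an unbounded connected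
    set off \<open>H\<close>.\<close>
  have corner: "K \<inter> Q = {}" if Q: "connected Q" "Q \<subseteq> T - (?h1 \<union> ?h2 \<union> ?h3)" "w \<in> V"
      "p w \<in> closure Q" "p w \<in> closure W" for Q w
  proof -
    have "connected (insert (p w) Q)"
      by (rule connected_intermediate_closure[OF Q(1)]) (use Q(4) closure_subset in auto)
    moreover have "connected (insert (p w) W)"
      by (rule connected_intermediate_closure[OF face(2)[OF W(1)]]) (use Q(5) closure_subset in auto)
    ultimately have "connected (insert (p w) Q \<union> insert (p w) W)"
      by (intro connected_Un) auto
    moreover have "(insert (p w) Q \<union> insert (p w) W) \<inter> H = {}"
      using vertex_not_in_H[OF Q(3)] WnH HT Q(2) by blast
    moreover have "\<not> bounded (insert (p w) Q \<union> insert (p w) W)"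
      using unb by simp
    ultimately show ?thesis using no_escape by blast
  qed
  have "K \<inter> Ka = {}" "K \<inter> Kb = {}"
    using corner[OF cK(1) _ _ cl(1) cW(1)] corner[OF cK(2) _ _ cl(2) cW(2)] R edge_vertices[OF ed(1)]
    by blast+
  \<comment> \<open>\<open>K\<close> contains a vertex of \<open>L\<close>, which is not in
    \<open>I\<close>. Being connected, \<open>K\<close> would have to cross the medians that bound
    \<open>I\<close> in order to enter it.\<close>
  moreover have "K \<inter> I = {}"
  proof (rule ccontr)
    assume "K \<inter> I \<noteq> {}"
    moreover have "p v \<notin> I" using R face(4)[OF T(1)] vertex_in_L[OF v(1)] by blast
    ultimately have "K \<inter> frontier I \<noteq> {}"
      using connected_Int_frontier[OF \<open>connected K\<close>] v(2) by blast
    then show False using fI hH KnH by blast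
  qed
  moreover have "K \<inter> T \<subseteq> Ka \<union> Kb \<union> Kc \<union> I"
    using R hH KnH by blast
  ultimately have "K \<inter> T \<subseteq> Kc" by blast
  then show False using T(2) xKc ab closure_mono by blast
qed

text \<open>The two faces at \<open>e\<close> are bounded, and each joins \<open>e\<close> to its
  other two sides. No third face contributes, so the neighbours of \<open>e\<close> are exactly the
  four edges in \<open>?N\<close>.\<close>

lemma degree_second_class:
  assumes K: "second_class_face V E p g m K" and e: "e \<in> E" "mid e \<in> frontier K"
  shows "vertex_degree (conj_edges V E p g) e = 4"
proof -
  obtain F G where F: "F \<in> faces V E p g" "mid e \<in> closure F" and G: "G \<in> faces V E p g" "mid e \<in> closure G"
    and "F \<noteq> G"
    using two_faces_at_edge[OF e(1)] .
  have bF: "bounded F" and bG: "bounded G"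
    using second_class_edge_not_outer[OF K e] F G by auto
  obtain a b where ab: "e = {a, b}" using edge_cases[OF e(1)] .
  obtain c where c: "triangle a b c" "frontier F = S a b \<union> (S a c \<union> S b c)"
    using face_at_edge[OF F(1)] F(2) e(1) ab by metis
  obtain d where d: "triangle a b d" "frontier G = S a b \<union> (S a d \<union> S b d)"
    using face_at_edge[OF G(1)] G(2) e(1) ab by metis
  \<comment> \<open>With equal apexes both faces would be the inside of the same triangle.\<close>
  have "c \<noteq> d"
    using bounded_face_inside[OF F(1) c bF] bounded_face_inside[OF G(1) d bG] \<open>F \<noteq> G\<close> by blast
  have dist: "a \<noteq> b" "a \<noteq> c" "b \<noteq> c" "a \<noteq> d" "b \<noteq> d"
    using c(1) d(1) unfolding triangle_def by auto
  have beF: "boundary_edges E g F = {e, {a, c}, {b, c}}" and beG: "boundary_edges E g G = {e, {a, d}, {b, d}}"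
    using boundary_edges_triangle c d ab by auto
  let ?N = "{{a, c}, {b, c}, {a, d}, {b, d}}"
  have "{d \<in> conj_edges V E p g. e \<in> d} = (\<lambda>f. {e, f}) ` ?N"
  proof
    show "{d \<in> conj_edges V E p g. e \<in> d} \<subseteq> (\<lambda>f. {e, f}) ` ?N"
    proof
      fix d' assume "d' \<in> {d \<in> conj_edges V E p g. e \<in> d}"
      then have d': "d' \<in> conj_edges V E p g" "e \<in> d'" by simp_all
      obtain f f' T where T: "d' = {f, f'}" "f \<noteq> f'" "T \<in> faces V E p g" "bounded T"
        "f \<in> boundary_edges E g T" "f' \<in> boundary_edges E g T"
        using conj_edgeE[OF d'(1)] .
      \<comment> \<open>\<open>h\<close> is the end of the median \<open>d'\<close> other than
        \<open>e\<close>.\<close>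
      define h where "h = (if e = f then f' else f)"
      have f: "d' = {e, h}" "e \<noteq> h" "h \<in> boundary_edges E g T" "e \<in> boundary_edges E g T"
        using T d'(2) unfolding h_def by auto
      then have "T = F \<or> T = G"
        using face_at_edge_cases[OF _ \<open>c \<noteq> d\<close> F(1) bF c G(1) bG d T(3)] boundary_edge_mid[OF f(4)] e(1) ab
        by blast
      then have "h \<in> {e, {a, c}, {b, c}} \<or> h \<in> {e, {a, d}, {b, d}}"
        using f(3) beF beG by metis
      then have "h \<in> ?N" using f(2) by blast
      then show "d' \<in> (\<lambda>f. {e, f}) ` ?N" using f(1) by blast
    qed
    have ne: "e \<noteq> {a, c}" "e \<noteq> {b, c}" "e \<noteq> {a, d}" "e \<noteq> {b, d}"
      using ab dist by (auto simp: doubleton_eq_iff)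
    then show "(\<lambda>f. {e, f}) ` ?N \<subseteq> {d \<in> conj_edges V E p g. e \<in> d}"
      using conj_edgeI[OF F(1) bF, of e, unfolded beF] conj_edgeI[OF G(1) bG, of e, unfolded beG]
      by simp
  qed
  \<comment> \<open>For fixed \<open>e\<close> the pair \<open>{e, f}\<close> determines
    \<open>f\<close>, so medians at \<open>e\<close> are counted by their other ends.\<close>
  moreover have "card ((\<lambda>f. {e, f}) ` ?N) = card ?N"
    by (rule card_image) (auto simp: inj_on_def doubleton_eq_iff)
  moreover have "card ?N = 4"
    using dist \<open>c \<noteq> d\<close> by (auto simp: card_insert_if doubleton_eq_iff)
  ultimately show ?thesis
    unfolding vertex_degree_def by (simp only:)
qed

end

theorem theorem12:
  fixes V :: "'a set" and E :: "'a set set"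
    and p :: "'a \<Rightarrow> complex" and g :: "'a set \<Rightarrow> real \<Rightarrow> complex"
    and m :: "'a set set \<Rightarrow> real \<Rightarrow> complex"
  assumes "plane_triangulation V E p g"
    and "card V \<ge> 3"
    and "conjugated_triangulation V E p g m"
  shows "\<forall>F. second_class_face V E p g m F \<longrightarrow>
           (\<forall>e\<in>E. edge_midpoint g e \<in> frontier F \<longrightarrow> vertex_degree (conj_edges V E p g) e = 4)"
proof -
  interpret conjugated V E p g m
    using assms(1,3) by unfold_locales
  show ?thesis using degree_second_class by blast
qed

end
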